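(* Let $f:\mathbb{R}^n\to\mathbb{R}$ be quasi-convex and continuous, let $X\subseteq\mathbb{R}^n$ be nonempty, closed and convex, and let $f^*$ and $X^*\neq\emptyset$ be the minimum value and the set of minimizers of $f$ over $X$. Fix $\epsilon\ge 0$ and $p\in(0,1]$. Let $\{x_k\}_{k\in\mathbb{N}}\subseteq X$, let $\{v_k\}$ be a sequence of stepsizes, and let $\{\alpha_k\},\{\beta_k\}$ be sequences of positive scalars with $\lim_{k\to\infty}\alpha_k=\alpha>0$ and $\lim_{k\to\infty}\beta_k=\beta>0$, such that for each $x^*\in X^*$ and each $k\in\mathbb{N}$ with $f(x_k)>f^*+\epsilon$, $$\|x_{k+1}-x^*\|^2-\|x_k-x^*\|^2\le-\alpha_kv_k\,(f(x_k)-f^*-\epsilon)^{\frac1p}+\beta_kv_k^2 .$$ Then the following hold. (i) If $v_k\equiv v>0$, then $\liminf_{k\to\infty}f(x_k)\le f^*+\left(\frac{\beta v}{\alpha}\right)^p+\epsilon$. (ii) If $v_k=ck^{-s}$ for all $k$, where $c>0$ and $s\in(0,1)$, then $\liminf_{k\to\infty}f(x_k)\le f^*+\epsilon$. (iii) If $v_k=\frac{\alpha_k\lambda_k}{2\beta_k}[f(x_k)-f^*-\epsilon]_+^{\frac1p}$ for all $k$, where $0<\underline{\lambda}\le\lambda_k\le\overline{\lambda}<2$, then either $x_k\in X^*_\epsilon$ for some $k\in\mathbb{N}$, or $\lim_{k\to\infty}f(x_k)$ exists and $\lim_{k\to\infty}f(x_k)\le f^*+\epsilon$.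
   Context: $\mathbb{N}=\{1,2,\dots\}$; $\|\cdot\|$ is the Euclidean norm on $\mathbb{R}^n$; $[t]_+=\max\{t,0\}$. A function $f:\mathbb{R}^n\to\mathbb{R}$ is quasi-convex if $f((1-a)x+ay)\le\max\{f(x),f(y)\}$ for all $x,y\in\mathbb{R}^n$, $a\in[0,1]$. $X^*_\epsilon:=\{x\in X: f(x)\le f^*+\epsilon\}$. *)

theory Defs
  imports "HOL-Analysis.Analysis"
begin

definition quasiconvex :: "('a::real_vector \<Rightarrow> real) \<Rightarrow> bool" where
  "quasiconvex f \<longleftrightarrow>
    (\<forall>x y. \<forall>a\<in>{0..1}. f ((1 - a) *\<^sub>R x + a *\<^sub>R y) \<le> max (f x) (f y))"

definition minimizers :: "('a \<Rightarrow> real) \<Rightarrow> 'a set \<Rightarrow> 'a set" where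
  "minimizers f X = {x. is_arg_min f (\<lambda>y. y \<in> X) x}"

(* This is the minimum of f over X only if the minimum is attained, i.e. if
   minimizers f X is nonempty; otherwise it is just a real-valued INF. *)
definition min_value :: "('a \<Rightarrow> real) \<Rightarrow> 'a set \<Rightarrow> real" where
  "min_value f X = (INF x\<in>X. f x)"

definition eps_minimizers :: "('a \<Rightarrow> real) \<Rightarrow> 'a set \<Rightarrow> real \<Rightarrow> 'a set" where
  "eps_minimizers f X \<epsilon> = {x \<in> X. f x \<le> min_value f X + \<epsilon>}"

lemma min_value_eq:
  assumes "x \<in> minimizers f X"
  shows "min_value f X = f x"
  unfolding min_value_def
proof (rule cInf_eq_minimum)
  show "f x \<in> f ` X"
    using assms by (auto simp: minimizers_def is_arg_min_def)
  show "\<And>y. y \<in> f ` X \<Longrightarrow> f x \<le> y"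
    using assms by (auto simp: minimizers_def is_arg_min_linorder)
qed

end

theory Submission
  imports Defs
begin

text \<open>For a fixed minimizer \<open>z\<close>, the squared distance \<open>d k = (norm (x k - z))\<^sup>2\<close> is nonnegative, so
  any nonnegative amounts by which it eventually decreases at each step form a convergent series.
  In (i) and (ii), a liminf above the bound would force decreases of at least a constant multiple
  of \<open>v k\<close>, whose series diverges. In (iii), the step size turns the right-hand side into
  \<open>- (\<alpha> k)\<^sup>2 * lam k * (2 - lam k) / (4 * \<beta> k)\<close> times the square of
  \<open>(f (x k) - fstar - \<epsilon>) powr (1 / p)\<close>; these terms tend to 0, and the coefficient
  stays away from 0.\<close>

text \<open>Telescoping from the index \<open>N\<close> at which the decrease sets in bounds every
  partial sum by \<open>d N\<close>, because \<open>d\<close> never drops below 0.\<close>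

lemma summable_of_eventually_decrease:
  fixes d g :: "nat \<Rightarrow> real"
  assumes d_nonneg: "\<And>k. d k \<ge> 0"
    and ev: "\<forall>\<^sub>F k in sequentially. 0 \<le> g k \<and> d (Suc k) \<le> d k - g k"
  shows "summable g"
proof -
  obtain N where N: "\<And>k. k \<ge> N \<Longrightarrow> 0 \<le> g k \<and> d (Suc k) \<le> d k - g k"
    using ev by (auto simp: eventually_sequentially)
  have tele: "(\<Sum>i<n. g (i + N)) \<le> d N - d (n + N)" for n
  proof (induction n)
    case (Suc n)
    then show ?case using N[of "n + N"] by simp
  qed simp
  have "summable (\<lambda>i. g (i + N))"
  proof (rule summableI_nonneg_bounded)
    show "(\<Sum>i<n. g (i + N)) \<le> d N" for n
      using tele[of n] d_nonneg[of "n + N"] by linarith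
  qed (use N in auto)
  then show ?thesis
    by (simp add: summable_iff_shift)
qed

text \<open>Serves (i) and (ii) at once: constant steps have \<open>v0 = w\<close>, diminishing
  steps have \<open>v0 = 0\<close>. The first-order gain in \<open>v k\<close> beats the quadratic
  loss as soon as the root of the gap stays above \<open>b * v0 / a\<close>.\<close>

lemma liminf_le_of_nonsummable_steps:
  fixes d \<phi> v \<alpha> \<beta> :: "nat \<Rightarrow> real"
  assumes d_nonneg: "\<And>k. d k \<ge> 0"
    and decrease: "\<forall>\<^sub>F k in sequentially. \<phi> k > \<mu> \<longrightarrow>
      d (Suc k) - d k \<le> - \<alpha> k * v k * (\<phi> k - \<mu>) powr (1 / p) + \<beta> k * (v k)\<^sup>2"
    and "\<alpha> \<longlonglongrightarrow> a" "a > 0" "\<beta> \<longlonglongrightarrow> b" "b > 0" "p > 0"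
    and "v \<longlonglongrightarrow> v0" "v0 \<ge> 0"
    and v_nonneg: "\<forall>\<^sub>F k in sequentially. v k \<ge> 0" and "\<not> summable v"
  shows "liminf (\<lambda>k. ereal (\<phi> k)) \<le> ereal (\<mu> + (b * v0 / a) powr p)"
proof (rule ccontr)
  assume "\<not> ?thesis"
  then obtain C where C: "\<mu> + (b * v0 / a) powr p < C" "ereal C < liminf (\<lambda>k. ereal (\<phi> k))"
    by (metis not_le ereal_dense2 less_ereal.simps(1))
  have ev_C: "\<forall>\<^sub>F k in sequentially. C < \<phi> k"
    using less_LiminfD[OF C(2)] by simp
  \<comment> \<open>\<open>H\<close> eventually bounds the root of the gap
    \<open>\<phi> k - \<mu>\<close> from below. Taking \<open>powr (1 / p)\<close> in the choice of
    \<open>C\<close> puts it strictly above \<open>b * v0 / a\<close>, which is nonnegative, so the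
    two powers cancel.\<close>
  define H where "H = (C - \<mu>) powr (1 / p)"
  have "((b * v0 / a) powr p) powr (1 / p) < H"
    unfolding H_def using C(1) \<open>p > 0\<close> by (intro powr_less_mono2) auto
  then have "b * v0 / a < H"
    using assms by (simp add: powr_powr)
  then have "0 < a * H - b * v0"
    using \<open>a > 0\<close> by (simp add: pos_divide_less_eq mult.commute[of H a])
  then obtain \<delta> where "\<delta> > 0" "\<delta> < a * H - b * v0"
    using dense by blast
  \<comment> \<open>This is the guaranteed decrease of \<open>d\<close> per unit of step size; its
    limit is positive, so it eventually exceeds the constant \<delta>.\<close>
  have "(\<lambda>k. \<alpha> k * H - \<beta> k * v k) \<longlonglongrightarrow> a * H - b * v0"
    using assms by (intro tendsto_intros)
  then have ev_\<delta>: "\<forall>\<^sub>F k in sequentially. \<delta> < \<alpha> k * H - \<beta> k * v k"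
    using \<open>\<delta> < a * H - b * v0\<close> by (rule order_tendstoD)
  have ev_\<alpha>: "\<forall>\<^sub>F k in sequentially. 0 < \<alpha> k"
    using order_tendstoD(1)[OF \<open>\<alpha> \<longlonglongrightarrow> a\<close> \<open>a > 0\<close>] .
  have "\<forall>\<^sub>F k in sequentially. 0 \<le> \<delta> * v k \<and> d (Suc k) \<le> d k - \<delta> * v k"
    using ev_C ev_\<delta> ev_\<alpha> v_nonneg decrease
  proof eventually_elim
    case (elim k)
    \<comment> \<open>\<open>\<mu> < C\<close> makes the bases of both powers nonnegative, as
      monotonicity requires, and triggers the premise of \<open>decrease\<close>.\<close>
    have "(b * v0 / a) powr p \<ge> 0" by simp
    then have "\<mu> < C" using C(1) by linarith
    then have "H \<le> (\<phi> k - \<mu>) powr (1 / p)"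
      unfolding H_def using elim(1) \<open>p > 0\<close> by (intro powr_mono2) auto
    then have "\<alpha> k * v k * H \<le> \<alpha> k * v k * (\<phi> k - \<mu>) powr (1 / p)"
      using elim(3,4) by (intro mult_left_mono) auto
    moreover have "\<delta> * v k \<le> (\<alpha> k * H - \<beta> k * v k) * v k"
      using elim(2,4) by (intro mult_right_mono) auto
    moreover have "d (Suc k) - d k
        \<le> - (\<alpha> k * v k * (\<phi> k - \<mu>) powr (1 / p)) + \<beta> k * (v k)\<^sup>2"
      using elim(1,5) \<open>\<mu> < C\<close> by simp
    ultimately have "d (Suc k) \<le> d k - \<delta> * v k"
      by (simp add: algebra_simps power2_eq_square)
    then show ?case
      using elim(4) \<open>\<delta> > 0\<close> by simp
  qed
  then have "summable (\<lambda>k. \<delta> * v k)"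
    by (rule summable_of_eventually_decrease[OF d_nonneg])
  then show False
    using \<open>\<delta> > 0\<close> \<open>\<not> summable v\<close> by (simp add: summable_cmult_iff)
qed

text \<open>With \<open>G\<close> the root of the gap, the bound
  \<open>- \<alpha> * v * G + \<beta> * v^2\<close> is a quadratic in \<open>v\<close> that vanishes
  at the steps given by \<open>lam = 0\<close> and \<open>lam = 2\<close> and is negative in
  between. Keeping \<open>lam\<close> in a compact part of that interval makes the decrease
  comparable to \<open>G^2\<close>.\<close>

lemma tendsto_of_polyak_steps:
  fixes d \<phi> v \<alpha> \<beta> lam :: "nat \<Rightarrow> real"
  assumes d_nonneg: "\<And>k. d k \<ge> 0"
    and above: "\<forall>\<^sub>F k in sequentially. \<phi> k > \<mu>"
    and decrease: "\<forall>\<^sub>F k in sequentially.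
      d (Suc k) - d k \<le> - \<alpha> k * v k * (\<phi> k - \<mu>) powr (1 / p) + \<beta> k * (v k)\<^sup>2"
    and "\<alpha> \<longlonglongrightarrow> a" "a > 0" "\<beta> \<longlonglongrightarrow> b" "b > 0" "p > 0"
    and "0 < l" "u < 2" and lam: "\<forall>\<^sub>F k in sequentially. l \<le> lam k \<and> lam k \<le> u"
    and v: "\<forall>\<^sub>F k in sequentially.
      v k = \<alpha> k * lam k / (2 * \<beta> k) * (\<phi> k - \<mu>) powr (1 / p)"
  shows "\<phi> \<longlonglongrightarrow> \<mu>"
proof -
  define G where "G k = (\<phi> k - \<mu>) powr (1 / p)" for k
  \<comment> \<open>Half the limit of \<open>(\<alpha> k)^2 / \<beta> k\<close>, hence eventually a
    strict lower bound for it. The 4 in \<open>m\<close> is the one produced by substituting the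
    step size.\<close>
  define \<kappa> where "\<kappa> = a\<^sup>2 / b / 2"
  define m where "m = \<kappa> * (l * (2 - u)) / 4"
  have "\<kappa> > 0"
    using assms by (simp add: \<kappa>_def)
  then have "m > 0"
    using assms by (simp add: m_def)
  have "(\<lambda>k. (\<alpha> k)\<^sup>2 / \<beta> k) \<longlonglongrightarrow> a\<^sup>2 / b"
    using assms by (intro tendsto_intros) auto
  moreover have "\<kappa> < a\<^sup>2 / b"
    using \<open>\<kappa> > 0\<close> by (simp add: \<kappa>_def)
  ultimately have ev_\<kappa>: "\<forall>\<^sub>F k in sequentially. \<kappa> < (\<alpha> k)\<^sup>2 / \<beta> k"
    by (rule order_tendstoD)
  have ev_\<beta>: "\<forall>\<^sub>F k in sequentially. 0 < \<beta> k"
    using order_tendstoD(1)[OF \<open>\<beta> \<longlonglongrightarrow> b\<close> \<open>b > 0\<close>] .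
  have "\<forall>\<^sub>F k in sequentially. 0 \<le> m * (G k)\<^sup>2 \<and> d (Suc k) \<le> d k - m * (G k)\<^sup>2"
    using ev_\<kappa> ev_\<beta> lam v decrease
  proof eventually_elim
    case (elim k)
    have "l * (2 - u) \<le> lam k * (2 - lam k)"
      using elim(3) \<open>0 < l\<close> \<open>u < 2\<close> by (intro mult_mono) auto
    then have "\<kappa> * (l * (2 - u)) \<le> (\<alpha> k)\<^sup>2 / \<beta> k * (lam k * (2 - lam k))"
      using elim(1) \<open>\<kappa> > 0\<close> \<open>0 < l\<close> \<open>u < 2\<close>
      by (intro mult_mono[of \<kappa>]) auto
    then have "m * (G k)\<^sup>2 \<le> (\<alpha> k)\<^sup>2 / \<beta> k * (lam k * (2 - lam k)) / 4 * (G k)\<^sup>2"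
      unfolding m_def by (intro mult_right_mono divide_right_mono) auto
    also have "\<dots> = \<alpha> k * v k * G k - \<beta> k * (v k)\<^sup>2"
      using elim(2) by (simp add: elim(4) G_def[symmetric] power2_eq_square field_simps)
    also have "\<dots> \<le> d k - d (Suc k)"
      using elim(5) by (simp add: G_def)
    finally show ?case
      using \<open>m > 0\<close> by simp
  qed
  then have "summable (\<lambda>k. m * (G k)\<^sup>2)"
    by (rule summable_of_eventually_decrease[OF d_nonneg])
  then have "(\<lambda>k. (G k)\<^sup>2) \<longlonglongrightarrow> 0"
    using \<open>m > 0\<close> by (intro summable_LIMSEQ_zero) (simp add: summable_cmult_iff)
  then have "G \<longlonglongrightarrow> 0"
    using tendsto_real_sqrt[of "\<lambda>k. (G k)\<^sup>2" 0] by (simp add: tendsto_rabs_zero_iff)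
  \<comment> \<open>The base tends to 0, where continuity of \<open>powr\<close> needs
    \<open>G\<close> nonnegative and the exponent positive. The power then undoes the root, since
    the gap is eventually positive.\<close>
  then have "(\<lambda>k. G k powr p) \<longlonglongrightarrow> 0 powr p"
    using \<open>p > 0\<close> \<open>G \<longlonglongrightarrow> 0\<close> by (intro tendsto_powr2) (auto intro!: always_eventually simp: G_def[abs_def])
  moreover have "\<forall>\<^sub>F k in sequentially. G k powr p = \<phi> k - \<mu>"
    using above by eventually_elim (use \<open>p > 0\<close> in \<open>simp add: G_def powr_powr\<close>)
  ultimately have "(\<lambda>k. \<phi> k - \<mu>) \<longlonglongrightarrow> 0"
    by (auto dest: tendsto_cong)
  then show ?thesis
    by (simp add: LIM_zero_iff)
qed

theorem theorem3p1:
  fixes f :: "real ^ 'n \<Rightarrow> real" and X :: "(real ^ 'n) set"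
    and x :: "nat \<Rightarrow> real ^ 'n"
    and v \<alpha> \<beta> :: "nat \<Rightarrow> real"
    and \<epsilon> p a b fstar :: real
  assumes "quasiconvex f" and "continuous_on UNIV f"
    and "X \<noteq> {}" and "closed X" and "convex X"
    and "minimizers f X \<noteq> {}"
    and fstar: "fstar = min_value f X"
    and "\<epsilon> \<ge> 0" and "0 < p" and "p \<le> 1"
    and "\<And>k. k \<ge> 1 \<Longrightarrow> x k \<in> X"
    and "\<And>k. k \<ge> 1 \<Longrightarrow> \<alpha> k > 0"
    and "\<And>k. k \<ge> 1 \<Longrightarrow> \<beta> k > 0"
    and "\<alpha> \<longlonglongrightarrow> a" and "a > 0"
    and "\<beta> \<longlonglongrightarrow> b" and "b > 0"
    and "\<And>xs k. xs \<in> minimizers f X \<Longrightarrow> k \<ge> 1 \<Longrightarrow> f (x k) > fstar + \<epsilon> \<Longrightarrow>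
           (norm (x (k + 1) - xs))\<^sup>2 - (norm (x k - xs))\<^sup>2
             \<le> - \<alpha> k * v k * (f (x k) - fstar - \<epsilon>) powr (1 / p) + \<beta> k * (v k)\<^sup>2"
  shows
    "(\<forall>w>0. (\<forall>k\<ge>1. v k = w) \<longrightarrow>
        liminf (\<lambda>k. ereal (f (x k))) \<le> ereal (fstar + (b * w / a) powr p + \<epsilon>))
     \<and>
     (\<forall>c s. c > 0 \<and> 0 < s \<and> s < 1 \<and> (\<forall>k\<ge>1. v k = c * real k powr (- s)) \<longrightarrow>
        liminf (\<lambda>k. ereal (f (x k))) \<le> ereal (fstar + \<epsilon>))
     \<and>
     (\<forall>lam l u. 0 < l \<and> u < 2 \<and> (\<forall>k\<ge>1. l \<le> lam k \<and> lam k \<le> u) \<and>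
        (\<forall>k\<ge>1. v k = \<alpha> k * lam k / (2 * \<beta> k) * (max (f (x k) - fstar - \<epsilon>) 0) powr (1 / p)) \<longrightarrow>
        (\<exists>k\<ge>1. x k \<in> eps_minimizers f X \<epsilon>) \<or>
        (\<exists>L. (\<lambda>k. f (x k)) \<longlonglongrightarrow> L \<and> L \<le> fstar + \<epsilon>))"
proof -
  obtain z where z: "z \<in> minimizers f X"
    using assms by blast
  define d where "d k = (norm (x k - z))\<^sup>2" for k
  define \<mu> where "\<mu> = fstar + \<epsilon>"
  have d_nonneg: "d k \<ge> 0" for k
    by (simp add: d_def)
  have step: "d (Suc k) - d k \<le> - \<alpha> k * v k * (f (x k) - \<mu>) powr (1 / p) + \<beta> k * (v k)\<^sup>2"
    if "k \<ge> 1" "f (x k) > \<mu>" for k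
    using assms(18)[OF z that(1)] that(2) by (simp add: d_def \<mu>_def diff_diff_eq)
  \<comment> \<open>The sequences start at index 1, so their values at 0 are arbitrary; eventual
    statements discard them.\<close>
  have steps: "\<forall>\<^sub>F k in sequentially. f (x k) > \<mu> \<longrightarrow>
      d (Suc k) - d k \<le> - \<alpha> k * v k * (f (x k) - \<mu>) powr (1 / p) + \<beta> k * (v k)\<^sup>2"
    using eventually_ge_at_top[of 1] by eventually_elim (use step in auto)
  note liminf_le = liminf_le_of_nonsummable_steps[where \<phi> = "\<lambda>k. f (x k)",
      OF d_nonneg steps \<open>\<alpha> \<longlonglongrightarrow> a\<close> \<open>a > 0\<close> \<open>\<beta> \<longlonglongrightarrow> b\<close> \<open>b > 0\<close> \<open>0 < p\<close>]
  show ?thesis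
  proof (intro conjI allI impI)
    fix w :: real
    assume "w > 0" and v: "\<forall>k\<ge>1. v k = w"
    have ev: "\<forall>\<^sub>F k in sequentially. v k = w"
      using eventually_ge_at_top[of 1] by eventually_elim (use v in auto)
    have "\<not> summable v"
      using \<open>w > 0\<close> by (simp add: summable_cong[OF ev] summable_const_iff)
    moreover have "v \<longlonglongrightarrow> w"
      using ev by (rule tendsto_eventually)
    moreover have "\<forall>\<^sub>F k in sequentially. v k \<ge> 0"
      using ev by eventually_elim (use \<open>w > 0\<close> in simp)
    ultimately show "liminf (\<lambda>k. ereal (f (x k))) \<le> ereal (fstar + (b * w / a) powr p + \<epsilon>)"
      using liminf_le[of w] \<open>w > 0\<close> by (simp add: \<mu>_def algebra_simps)
  next
    fix c s :: real
    assume cs: "c > 0 \<and> 0 < s \<and> s < 1 \<and> (\<forall>k\<ge>1. v k = c * real k powr (- s))"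
    have ev: "\<forall>\<^sub>F k in sequentially. v k = c * real k powr (- s)"
      using eventually_ge_at_top[of 1] by eventually_elim (use cs in auto)
    \<comment> \<open>The exponent \<open>- s\<close> lies strictly between -1 and 0, so the series
      diverges although its terms tend to 0.\<close>
    have "\<not> summable v"
      using cs by (simp add: summable_cong[OF ev] summable_cmult_iff summable_real_powr_iff)
    moreover have "(\<lambda>k. c * real k powr (- s)) \<longlonglongrightarrow> c * 0"
      using cs by (intro tendsto_mult tendsto_const tendsto_neg_powr filterlim_real_sequentially) auto
    then have "v \<longlonglongrightarrow> 0"
      using tendsto_cong[OF ev] by simp
    moreover have "\<forall>\<^sub>F k in sequentially. v k \<ge> 0"
      using ev by eventually_elim (use cs in simp)
    \<comment> \<open>With limit step 0 the error term is \<open>0 powr p\<close>, which is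
      0.\<close>
    ultimately show "liminf (\<lambda>k. ereal (f (x k))) \<le> ereal (fstar + \<epsilon>)"
      using liminf_le[of 0] by (simp add: \<mu>_def)
  next
    fix lam :: "nat \<Rightarrow> real" and l u :: real
    assume *: "0 < l \<and> u < 2 \<and> (\<forall>k\<ge>1. l \<le> lam k \<and> lam k \<le> u) \<and>
        (\<forall>k\<ge>1. v k = \<alpha> k * lam k / (2 * \<beta> k) * (max (f (x k) - fstar - \<epsilon>) 0) powr (1 / p))"
    show "(\<exists>k\<ge>1. x k \<in> eps_minimizers f X \<epsilon>) \<or>
        (\<exists>L. (\<lambda>k. f (x k)) \<longlonglongrightarrow> L \<and> L \<le> fstar + \<epsilon>)"
    proof (rule disjCI)
      assume no_limit: "\<nexists>L. (\<lambda>k. f (x k)) \<longlonglongrightarrow> L \<and> L \<le> fstar + \<epsilon>"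
      show "\<exists>k\<ge>1. x k \<in> eps_minimizers f X \<epsilon>"
      proof (rule ccontr)
        assume "\<not> ?thesis"
        \<comment> \<open>If no iterate is an \<epsilon>-minimizer, the step inequality applies at
          every index from 1 on, and the limit turns out to be exactly \<mu>.\<close>
        then have above: "f (x k) > \<mu>" if "k \<ge> 1" for k
          using that assms(11)[OF that] by (auto simp: eps_minimizers_def \<mu>_def fstar not_le)
        have "(\<lambda>k. f (x k)) \<longlonglongrightarrow> \<mu>"
        proof (rule tendsto_of_polyak_steps[where d = d and v = v and \<alpha> = \<alpha> and \<beta> = \<beta>
              and lam = lam and l = l and u = u and a = a and b = b and p = p])
          show "\<forall>\<^sub>F k in sequentially. f (x k) > \<mu>"
            using eventually_ge_at_top[of 1] by eventually_elim (use above in auto)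
          show "\<forall>\<^sub>F k in sequentially.
              d (Suc k) - d k \<le> - \<alpha> k * v k * (f (x k) - \<mu>) powr (1 / p) + \<beta> k * (v k)\<^sup>2"
            using eventually_ge_at_top[of 1] by eventually_elim (use above step in auto)
          show "\<forall>\<^sub>F k in sequentially. l \<le> lam k \<and> lam k \<le> u"
            using eventually_ge_at_top[of 1] by eventually_elim (use * in auto)
          show "\<forall>\<^sub>F k in sequentially.
              v k = \<alpha> k * lam k / (2 * \<beta> k) * (f (x k) - \<mu>) powr (1 / p)"
            using eventually_ge_at_top[of 1]
          proof eventually_elim
            case (elim k)
            \<comment> \<open>Above \<mu> the positive part in the step size is the gap
              itself.\<close>
            then have "max (f (x k) - fstar - \<epsilon>) 0 = f (x k) - \<mu>"
              using above[of k] by (simp add: \<mu>_def)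
            with * elim show ?case by simp
          qed
        qed (use * assms d_nonneg in auto)
        with no_limit show False
          by (auto simp: \<mu>_def)
      qed
    qed
  qed
qed

end
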